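(* For $\gamma\in\mathbb{C}$, let $(S,\circ_\gamma)$ be the graded anti-pre-Lie algebraic structure on the Witt algebra $\mathcal{W}$ defined by $$W_n\circ_\gamma W_m=-(\gamma+m+2n)W_{m+n},\qquad \forall m,n\in\mathbb{Z}.$$ Let $\gamma_1,\gamma_2\in\mathbb{C}$. Then $(S,\circ_{\gamma_1})$ and $(S,\circ_{\gamma_2})$ are isomorphic (as anti-pre-Lie algebras) if and only if $\gamma_1=\gamma_2$ or $\gamma_1=-\gamma_2$.
   Context: All vector spaces and algebras are over $\mathbb{C}$. An anti-pre-Lie algebra is a vector space $A$ with a bilinear operation $\circ$ such that, with $[x,y]=x\circ y-y\circ x$, for all $x,y,z\in A$: $x\circ(y\circ z)-y\circ(x\circ z)=[y,x]\circ z$ and $[[x,y],z]+[[y,z],x]+[[z,x],y]=0$. The commutator $[\cdot,\cdot]$ then is a Lie bracket on $A$, and $(A,\circ)$ is called an anti-pre-Lie algebraic structure on a Lie algebra $\mathfrak{g}$ if the underlying vector space of $\mathfrak g$ is $A$ and the Lie bracket of $\mathfrak g$ is this commutator. An isomorphism of anti-pre-Lie algebras is a linear bijection preserving the operations. The Witt algebra $\mathcal{W}$ is the Lie algebra with basis $\{W_m : m\in\mathbb{Z}\}$ and bracket $[W_m,W_n]=(n-m)W_{m+n}$ for all $m,n\in\mathbb{Z}$. A graded anti-pre-Lie algebraic structure on $\mathcal{W}$ is an anti-pre-Lie algebraic structure on $\mathcal{W}$ such that $W_m\circ W_n=\varphi(m,n)W_{m+n}$ for all $m,n\in\mathbb{Z}$,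 for some function $\varphi:\mathbb{Z}\times\mathbb{Z}\to\mathbb{C}$. For every $\gamma\in\mathbb{C}$ the formula for $\circ_\gamma$ does define such a structure, with underlying vector space $S=\mathcal{W}$. *)

theory Defs
  imports Complex_Main "HOL-Library.Poly_Mapping"
begin

section \<open>Lie algebras and anti-pre-Lie algebras over the complex numbers\<close>

definition bilinear_op ::
  "(complex \<Rightarrow> 'a::ab_group_add \<Rightarrow> 'a) \<Rightarrow> ('a \<Rightarrow> 'a \<Rightarrow> 'a) \<Rightarrow> bool" where
  "bilinear_op scale mul \<longleftrightarrow>
     (\<forall>x. Vector_Spaces.linear scale scale (\<lambda>y. mul x y)) \<and>
     (\<forall>y. Vector_Spaces.linear scale scale (\<lambda>x. mul x y))"

definition commutator :: "('a::ab_group_add \<Rightarrow> 'a \<Rightarrow> 'a) \<Rightarrow> 'a \<Rightarrow> 'a \<Rightarrow> 'a" where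
  "commutator mul x y = mul x y - mul y x"

locale Lie_algebra = vector_space scale
  for scale :: "complex \<Rightarrow> 'a::ab_group_add \<Rightarrow> 'a" +
  fixes bracket :: "'a \<Rightarrow> 'a \<Rightarrow> 'a"
  assumes bracket_bilinear: "bilinear_op scale bracket"
    and bracket_self: "bracket x x = 0"
    and Jacobi: "bracket (bracket x y) z + bracket (bracket y z) x + bracket (bracket z x) y = 0"

locale anti_pre_Lie_algebra = vector_space scale
  for scale :: "complex \<Rightarrow> 'a::ab_group_add \<Rightarrow> 'a" +
  fixes mul :: "'a \<Rightarrow> 'a \<Rightarrow> 'a"
  assumes mul_bilinear: "bilinear_op scale mul"
    and anti_left_symmetry: "mul x (mul y z) - mul y (mul x z) = mul (commutator mul y x) z"
    and commutator_Jacobi: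
      "commutator mul (commutator mul x y) z + commutator mul (commutator mul y z) x
         + commutator mul (commutator mul z x) y = 0"

definition anti_pre_Lie_structure_on ::
  "(complex \<Rightarrow> 'a::ab_group_add \<Rightarrow> 'a) \<Rightarrow> ('a \<Rightarrow> 'a \<Rightarrow> 'a) \<Rightarrow> ('a \<Rightarrow> 'a \<Rightarrow> 'a) \<Rightarrow> bool" where
  "anti_pre_Lie_structure_on scale bracket mul \<longleftrightarrow>
     Lie_algebra scale bracket \<and> anti_pre_Lie_algebra scale mul \<and> commutator mul = bracket"

definition anti_pre_Lie_isomorphism ::
  "(complex \<Rightarrow> 'a::ab_group_add \<Rightarrow> 'a) \<Rightarrow> ('a \<Rightarrow> 'a \<Rightarrow> 'a) \<Rightarrow>
   (complex \<Rightarrow> 'b::ab_group_add \<Rightarrow> 'b) \<Rightarrow> ('b \<Rightarrow> 'b \<Rightarrow> 'b) \<Rightarrow> ('a \<Rightarrow> 'b) \<Rightarrow> bool" where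
  "anti_pre_Lie_isomorphism s1 mul1 s2 mul2 f \<longleftrightarrow>
     anti_pre_Lie_algebra s1 mul1 \<and> anti_pre_Lie_algebra s2 mul2 \<and>
     Vector_Spaces.linear s1 s2 f \<and> bij f \<and> (\<forall>x y. f (mul1 x y) = mul2 (f x) (f y))"

definition anti_pre_Lie_isomorphic ::
  "(complex \<Rightarrow> 'a::ab_group_add \<Rightarrow> 'a) \<Rightarrow> ('a \<Rightarrow> 'a \<Rightarrow> 'a) \<Rightarrow>
   (complex \<Rightarrow> 'b::ab_group_add \<Rightarrow> 'b) \<Rightarrow> ('b \<Rightarrow> 'b \<Rightarrow> 'b) \<Rightarrow> bool" where
  "anti_pre_Lie_isomorphic s1 mul1 s2 mul2 \<longleftrightarrow>
     (\<exists>f. anti_pre_Lie_isomorphism s1 mul1 s2 mul2 f)"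


section \<open>The Witt algebra\<close>

text \<open>
  The underlying vector space is the space of finitely supported functions from the integers
  to the complex numbers.  The ring multiplication that the library puts on this type
  (convolution) plays no role here.
\<close>

type_synonym witt = "int \<Rightarrow>\<^sub>0 complex"

definition witt_scale :: "complex \<Rightarrow> witt \<Rightarrow> witt" where
  "witt_scale c x = Poly_Mapping.map ((*) c) x"

definition W :: "int \<Rightarrow> witt" where
  "W m = Poly_Mapping.single m 1"

text \<open>The bilinear operation that sends (W m, W n) to phi m n times W (m + n).\<close>

definition graded_op :: "(int \<Rightarrow> int \<Rightarrow> complex) \<Rightarrow> witt \<Rightarrow> witt \<Rightarrow> witt" where
  "graded_op \<phi> x y =
     (\<Sum>m\<in>Poly_Mapping.keys x. \<Sum>n\<in>Poly_Mapping.keys y.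
        witt_scale (Poly_Mapping.lookup x m * Poly_Mapping.lookup y n * \<phi> m n) (W (m + n)))"

definition witt_bracket :: "witt \<Rightarrow> witt \<Rightarrow> witt" where
  "witt_bracket = graded_op (\<lambda>m n. of_int (n - m))"

definition graded_anti_pre_Lie_structure_on_witt :: "(witt \<Rightarrow> witt \<Rightarrow> witt) \<Rightarrow> bool" where
  "graded_anti_pre_Lie_structure_on_witt mul \<longleftrightarrow>
     anti_pre_Lie_structure_on witt_scale witt_bracket mul \<and>
     (\<exists>\<phi>. \<forall>m n. mul (W m) (W n) = witt_scale (\<phi> m n) (W (m + n)))"

definition witt_circ :: "complex \<Rightarrow> witt \<Rightarrow> witt \<Rightarrow> witt" where
  "witt_circ \<gamma> = graded_op (\<lambda>n m. - (\<gamma> + of_int m + 2 * of_int n))"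


section \<open>Basic facts\<close>

lemma lookup_witt_scale [simp]:
  "Poly_Mapping.lookup (witt_scale c x) k = c * Poly_Mapping.lookup x k"
  unfolding witt_scale_def by (simp add: Poly_Mapping.map.rep_eq when_def)

interpretation witt: vector_space witt_scale
  by unfold_locales (auto intro!: poly_mapping_eqI simp: lookup_add algebra_simps)

lemma witt_scale_W: "witt_scale c (W m) = Poly_Mapping.single m c"
  by (rule poly_mapping_eqI) (simp add: W_def lookup_single when_def)

lemma witt_expand: "x = (\<Sum>m\<in>Poly_Mapping.keys x. witt_scale (Poly_Mapping.lookup x m) (W m))"
  by (rule poly_mapping_eqI)
    (simp add: W_def lookup_sum lookup_single when_def if_distrib in_keys_iff cong: if_cong)

lemma inj_W: "inj W"
  by (rule injI) (metis W_def keys_single singleton_inject zero_neq_one)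

lemma witt_basis_span: "witt.span (range W) = UNIV"
proof -
  have "x \<in> witt.span (range W)" for x
    by (subst witt_expand) (intro witt.span_sum witt.span_scale witt.span_base rangeI)
  then show ?thesis by auto
qed

lemma witt_basis_independent: "witt.independent (range W)"
proof
  assume "witt.dependent (range W)"
  then obtain t u v where t: "finite t" "t \<subseteq> range W" "(\<Sum>a\<in>t. witt_scale (u a) a) = 0"
    "v \<in> t" "u v \<noteq> 0"
    unfolding witt.dependent_explicit by blast
  then obtain k where k: "v = W k" by blast
  have "0 = Poly_Mapping.lookup (\<Sum>a\<in>t. witt_scale (u a) a) k" using t(3) by simp
  also have "\<dots> = (\<Sum>a\<in>t. u a * Poly_Mapping.lookup a k)" by (simp add: lookup_sum)
  also have "\<dots> = (\<Sum>a\<in>t. if a = v then u v else 0)"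
  proof (rule sum.cong)
    fix a assume "a \<in> t"
    then obtain j where "a = W j" using t(2) by blast
    then show "u a * Poly_Mapping.lookup a k = (if a = v then u v else 0)"
      using k injD[OF inj_W, of j k] by (auto simp: W_def lookup_single when_def)
  qed simp
  also have "\<dots> = u v" using t by simp
  finally show False using t(5) by simp
qed

lemma graded_op_superset:
  assumes "finite A" "finite B" "Poly_Mapping.keys x \<subseteq> A" "Poly_Mapping.keys y \<subseteq> B"
  shows "graded_op \<phi> x y =
     (\<Sum>m\<in>A. \<Sum>n\<in>B.
        witt_scale (Poly_Mapping.lookup x m * Poly_Mapping.lookup y n * \<phi> m n) (W (m + n)))"
proof -
  have "(\<Sum>n\<in>Poly_Mapping.keys y.
        witt_scale (Poly_Mapping.lookup x m * Poly_Mapping.lookup y n * \<phi> m n) (W (m + n))) =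
      (\<Sum>n\<in>B. witt_scale (Poly_Mapping.lookup x m * Poly_Mapping.lookup y n * \<phi> m n) (W (m + n)))"
    for m
    by (rule sum.mono_neutral_left) (use assms in \<open>auto simp: in_keys_iff\<close>)
  then show ?thesis
    unfolding graded_op_def
    by (simp, intro sum.mono_neutral_left) (use assms in \<open>auto simp: in_keys_iff\<close>)
qed

lemma graded_op_W [simp]: "graded_op \<phi> (W m) (W n) = witt_scale (\<phi> m n) (W (m + n))"
  by (subst graded_op_superset[of "{m}" "{n}"]) (auto simp: W_def)

lemma graded_op_add_left: "graded_op \<phi> (x + y) z = graded_op \<phi> x z + graded_op \<phi> y z"
proof -
  let ?A = "Poly_Mapping.keys x \<union> Poly_Mapping.keys y" and ?B = "Poly_Mapping.keys z"
  have "Poly_Mapping.keys (x + y) \<subseteq> ?A" by (rule Poly_Mapping.keys_add)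
  then show ?thesis
    by (simp add: graded_op_superset[of ?A ?B] lookup_add witt.scale_left_distrib
        distrib_right sum.distrib)
qed

lemma graded_op_add_right: "graded_op \<phi> z (x + y) = graded_op \<phi> z x + graded_op \<phi> z y"
proof -
  let ?A = "Poly_Mapping.keys x \<union> Poly_Mapping.keys y" and ?B = "Poly_Mapping.keys z"
  have "Poly_Mapping.keys (x + y) \<subseteq> ?A" by (rule Poly_Mapping.keys_add)
  then show ?thesis
    by (simp add: graded_op_superset[of ?B ?A] lookup_add witt.scale_left_distrib
        distrib_left distrib_right sum.distrib)
qed

lemma keys_witt_scale: "Poly_Mapping.keys (witt_scale c x) \<subseteq> Poly_Mapping.keys x"
  by (auto simp: in_keys_iff)

lemma graded_op_scale_left: "graded_op \<phi> (witt_scale c x) z = witt_scale c (graded_op \<phi> x z)"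
  using keys_witt_scale[of c x]
  by (simp add: graded_op_superset[of "Poly_Mapping.keys x" "Poly_Mapping.keys z"]
      witt.scale_sum_right mult.assoc)

lemma graded_op_scale_right: "graded_op \<phi> z (witt_scale c x) = witt_scale c (graded_op \<phi> z x)"
  using keys_witt_scale[of c x]
  by (simp add: graded_op_superset[of "Poly_Mapping.keys z" "Poly_Mapping.keys x"]
      witt.scale_sum_right ac_simps)

lemmas graded_op_linear =
  graded_op_add_left graded_op_add_right graded_op_scale_left graded_op_scale_right

lemma graded_op_nested_right:
  "graded_op \<phi> (W l) (graded_op \<psi> (W m) (W n)) = witt_scale (\<psi> m n * \<phi> l (m + n)) (W (l + m + n))"
  by (simp add: graded_op_linear add.assoc)

lemma graded_op_nested_left:
  "graded_op \<phi> (graded_op \<psi> (W l) (W m)) (W n) = witt_scale (\<psi> l m * \<phi> (l + m) n) (W (l + m + n))"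
  by (simp add: graded_op_linear)

lemma bilinear_graded_op: "bilinear_op witt_scale (graded_op \<phi>)"
  unfolding bilinear_op_def
  by (auto simp: Vector_Spaces.linear_iff graded_op_linear witt.vector_space_axioms)

lemma witt_linear_eqI:
  assumes "\<And>x y. f (x + y) = f x + f y" "\<And>c x. f (witt_scale c x) = witt_scale c (f x)"
    and "\<And>x y. g (x + y) = g x + g y" "\<And>c x. g (witt_scale c x) = witt_scale c (g x)"
    and "\<And>m. f (W m) = g (W m)"
  shows "f x = g x"
proof -
  have "x \<in> witt.span (range W)" by (simp add: witt_basis_span)
  then show ?thesis
    by (induction rule: witt.span_induct_alt)
      (use assms(1,3) [of 0 0] assms in auto)
qed

lemma witt_bilinear_eqI:
  assumes "bilinear_op witt_scale f" "bilinear_op witt_scale g"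
    and "\<And>m n. f (W m) (W n) = g (W m) (W n)"
  shows "f = g"
proof (intro ext)
  fix x y
  have *: "f (W m) y = g (W m) y" for m
    by (rule witt_linear_eqI)
      (use assms in \<open>auto simp: bilinear_op_def Vector_Spaces.linear_iff\<close>)
  show "f x y = g x y"
    by (rule witt_linear_eqI[of "\<lambda>x. f x y" "\<lambda>x. g x y"])
      (use assms * in \<open>auto simp: bilinear_op_def Vector_Spaces.linear_iff\<close>)
qed

lemma witt_trilinear_eqI:
  assumes "\<And>x. bilinear_op witt_scale (f x)" "\<And>x. bilinear_op witt_scale (g x)"
    and "\<And>x x' y z. f (x + x') y z = f x y z + f x' y z"
    and "\<And>c x y z. f (witt_scale c x) y z = witt_scale c (f x y z)"
    and "\<And>x x' y z. g (x + x') y z = g x y z + g x' y z"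
    and "\<And>c x y z. g (witt_scale c x) y z = witt_scale c (g x y z)"
    and "\<And>l m n. f (W l) (W m) (W n) = g (W l) (W m) (W n)"
  shows "f x y z = g x y z"
proof -
  have *: "f (W l) = g (W l)" for l
    by (rule witt_bilinear_eqI) (rule assms)+
  show ?thesis
    by (rule witt_linear_eqI[of "\<lambda>x. f x y z" "\<lambda>x. g x y z"])
      (rule assms fun_cong[OF fun_cong[OF *]])+
qed

lemma witt_bracket_W: "witt_bracket (W m) (W n) = witt_scale (of_int (n - m)) (W (m + n))"
  by (simp add: witt_bracket_def)

lemma witt_circ_W:
  "witt_circ \<gamma> (W n) (W m) = witt_scale (- (\<gamma> + of_int m + 2 * of_int n)) (W (m + n))"
  by (simp add: witt_circ_def add.commute)

lemma commutator_witt_circ: "commutator (witt_circ \<gamma>) = witt_bracket"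
proof (rule witt_bilinear_eqI)
  show "bilinear_op witt_scale (commutator (witt_circ \<gamma>))"
    unfolding bilinear_op_def commutator_def witt_circ_def
    by (auto simp: Vector_Spaces.linear_iff graded_op_linear witt.vector_space_axioms
        witt.scale_right_diff_distrib)
  show "bilinear_op witt_scale witt_bracket"
    by (simp add: witt_bracket_def bilinear_graded_op)
  show "commutator (witt_circ \<gamma>) (W m) (W n) = witt_bracket (W m) (W n)" for m n
    by (simp add: commutator_def witt_circ_W witt_bracket_W add.commute
        witt.scale_left_diff_distrib[symmetric] del: witt.scale_minus_left)
qed

lemma Lie_algebra_witt: "Lie_algebra witt_scale witt_bracket"
proof
  let ?b = witt_bracket
  show bil: "bilinear_op witt_scale ?b"
    by (simp add: witt_bracket_def bilinear_graded_op)
  have "?b x x = commutator (witt_circ 0) x x" for x by (simp add: commutator_witt_circ)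
  then show "?b x x = 0" for x by (simp add: commutator_def)
  show "?b (?b x y) z + ?b (?b y z) x + ?b (?b z x) y = 0" for x y z
  proof (rule witt_trilinear_eqI[where g = "\<lambda>x y z. 0" and
        f = "\<lambda>x y z. ?b (?b x y) z + ?b (?b y z) x + ?b (?b z x) y"])
    show "?b (?b (W l) (W m)) (W n) + ?b (?b (W m) (W n)) (W l) + ?b (?b (W n) (W l)) (W m) = 0"
      for l m n
    proof -
      have idx: "m + n + l = l + m + n" "n + l + m = l + m + n" by simp_all
      show ?thesis
        unfolding witt_bracket_def graded_op_nested_left idx witt.scale_left_distrib[symmetric]
        by (rule trans[OF arg_cong[where f = "\<lambda>c. witt_scale c (W (l + m + n))"] witt.scale_zero_left])
          (simp add: ring_distribs)
    qed
  qed (simp_all only: bilinear_op_def Vector_Spaces.linear_iff witt_bracket_def graded_op_linear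
      witt.vector_space_axioms witt.scale_right_distrib witt.scale_zero_right add_0_left
      add.assoc add.commute add.left_commute simp_thms)
qed

lemma anti_pre_Lie_algebra_witt_circ: "anti_pre_Lie_algebra witt_scale (witt_circ \<gamma>)"
proof
  let ?c = "witt_circ \<gamma>"
  show "bilinear_op witt_scale ?c"
    by (simp add: witt_circ_def bilinear_graded_op)
  show "?c x (?c y z) - ?c y (?c x z) = ?c (commutator ?c y x) z" for x y z
    unfolding commutator_witt_circ
  proof (rule witt_trilinear_eqI[where f = "\<lambda>x y z. ?c x (?c y z) - ?c y (?c x z)" and
        g = "\<lambda>x y z. ?c (witt_bracket y x) z"])
    show "?c (W l) (?c (W m) (W n)) - ?c (W m) (?c (W l) (W n)) =
        ?c (witt_bracket (W m) (W l)) (W n)" for l m n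
    proof -
      have idx: "m + l + n = l + m + n" by simp
      show ?thesis
        unfolding witt_bracket_def witt_circ_def graded_op_nested_left graded_op_nested_right
          idx witt.scale_left_diff_distrib[symmetric]
        by (rule arg_cong[where f = "\<lambda>c. witt_scale c (W (l + m + n))"])
          (simp add: algebra_simps)
    qed
  qed (simp_all only: bilinear_op_def Vector_Spaces.linear_iff witt_bracket_def witt_circ_def
      graded_op_linear witt.vector_space_axioms witt.scale_right_diff_distrib add_diff_add
      simp_thms)
  interpret Lie_algebra witt_scale witt_bracket by (rule Lie_algebra_witt)
  show "commutator ?c (commutator ?c x y) z + commutator ?c (commutator ?c y z) x
      + commutator ?c (commutator ?c z x) y = 0" for x y z
    unfolding commutator_witt_circ by (rule Jacobi)
qed

lemma witt_circ_graded: "graded_anti_pre_Lie_structure_on_witt (witt_circ \<gamma>)"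
proof -
  have "\<exists>\<phi>. \<forall>m n. witt_circ \<gamma> (W m) (W n) = witt_scale (\<phi> m n) (W (m + n))"
    by (rule exI[of _ "\<lambda>n m. - (\<gamma> + of_int m + 2 * of_int n)"])
      (simp only: witt_circ_def graded_op_W simp_thms)
  then show ?thesis
    unfolding graded_anti_pre_Lie_structure_on_witt_def anti_pre_Lie_structure_on_def
    using Lie_algebra_witt anti_pre_Lie_algebra_witt_circ commutator_witt_circ by metis
qed

end

theory Submission
  imports Defs
begin

text \<open>
  The reflection sending \<open>W n\<close> to \<open>- W (- n)\<close> is an isomorphism from parameter \<open>\<gamma>\<close> to \<open>- \<gamma>\<close>.
  Conversely, let \<open>f\<close> be an isomorphism and \<open>x = f (W 0)\<close>.  Then \<open>ad x\<close> is diagonalizable.  If the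
  top degree \<open>N\<close> of \<open>x\<close> were positive, comparing top degrees in \<open>[x, y] = \<lambda> y\<close> would force every
  eigenvector \<open>y\<close> to have top degree \<open>N\<close>, although the eigenvectors span everything.  By reflection
  the bottom degree is not negative either, so \<open>x = c W 0\<close>.  The spectra of \<open>ad (W 0)\<close> and \<open>ad x\<close>
  agree, which gives \<open>c = \<plusminus>1\<close>, and applying \<open>f\<close> to \<open>W 0 \<circ> W 0 = - \<gamma>1 W 0\<close> gives \<open>\<gamma>1 = c \<gamma>2\<close>.
\<close>

lemma anti_pre_Lie_isomorphismD:
  assumes "anti_pre_Lie_isomorphism s1 mul1 s2 mul2 f"
  shows "bij f" "f (x + y) = f x + f y" "f (s1 c x) = s2 c (f x)"
    "f (mul1 x y) = mul2 (f x) (f y)"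
  using assms by (simp_all add: anti_pre_Lie_isomorphism_def Vector_Spaces.linear_iff)

lemma anti_pre_Lie_isomorphism_comp:
  assumes "anti_pre_Lie_isomorphism s1 mul1 s2 mul2 f"
    and "anti_pre_Lie_isomorphism s2 mul2 s3 mul3 g"
  shows "anti_pre_Lie_isomorphism s1 mul1 s3 mul3 (g \<circ> f)"
  using assms unfolding anti_pre_Lie_isomorphism_def
  by (auto simp: Vector_Spaces.linear_iff intro: bij_comp)

text \<open>All \<open>witt_circ\<close> structures share the commutator
  \<open>witt_bracket\<close>, so an isomorphism between two of them is an automorphism of the Witt
  Lie algebra.\<close>

lemma anti_pre_Lie_isomorphism_commutator:
  assumes "anti_pre_Lie_isomorphism s1 mul1 s2 mul2 f"
  shows "f (commutator mul1 x y) = commutator mul2 (f x) (f y)"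
proof -
  have "additive f"
    by (simp add: additive_def anti_pre_Lie_isomorphismD(2)[OF assms])
  then show ?thesis
    by (simp add: commutator_def additive.diff anti_pre_Lie_isomorphismD(4)[OF assms])
qed

lemma lookup_W: "Poly_Mapping.lookup (W m) k = (1 when m = k)"
  by (simp only: W_def lookup_single)

text \<open>Negating the indices alone would reverse the sign of the Witt bracket; the outer minus
  sign restores it.\<close>

definition reflection :: "witt \<Rightarrow> witt" where
  "reflection x = - Poly_Mapping.map_key uminus x"

lemma lookup_reflection [simp]:
  "Poly_Mapping.lookup (reflection x) k = - Poly_Mapping.lookup x (- k)"
  by (simp add: reflection_def map_key.rep_eq)

lemma reflection_W: "reflection (W n) = witt_scale (- 1) (W (- n))"
  by (rule poly_mapping_eqI) (auto simp: lookup_W when_def)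

lemma reflection_linear:
  "reflection (x + y) = reflection x + reflection y"
  "reflection (witt_scale c x) = witt_scale c (reflection x)"
  by (rule poly_mapping_eqI, simp add: lookup_add)+

lemma bij_reflection: "bij reflection"
  by (rule involuntory_imp_bij) (simp add: poly_mapping_eqI)

lemma reflection_witt_circ:
  "reflection (witt_circ \<gamma> x y) = witt_circ (- \<gamma>) (reflection x) (reflection y)"
proof -
  have "(\<lambda>x y. reflection (witt_circ \<gamma> x y)) =
      (\<lambda>x y. witt_circ (- \<gamma>) (reflection x) (reflection y))"
  proof (rule witt_bilinear_eqI)
    show "bilinear_op witt_scale (\<lambda>x y. reflection (witt_circ \<gamma> x y))"
      "bilinear_op witt_scale (\<lambda>x y. witt_circ (- \<gamma>) (reflection x) (reflection y))"
      unfolding bilinear_op_def witt_circ_def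
      by (auto simp: Vector_Spaces.linear_iff graded_op_linear reflection_linear
          witt.vector_space_axioms)
    \<comment> \<open>Both sides equal \<open>\<gamma> + n + 2 * m\<close> times
      \<open>W (- m - n)\<close>.\<close>
    show "reflection (witt_circ \<gamma> (W m) (W n)) =
        witt_circ (- \<gamma>) (reflection (W m)) (reflection (W n))" for m n
      by (rule poly_mapping_eqI)
        (simp add: reflection_W reflection_linear witt_circ_def graded_op_linear lookup_W when_def
          del: witt.scale_minus_left)
  qed
  then show ?thesis by metis
qed

lemma reflection_isomorphism:
  "anti_pre_Lie_isomorphism witt_scale (witt_circ \<gamma>) witt_scale (witt_circ (- \<gamma>)) reflection"
  by (simp add: anti_pre_Lie_isomorphism_def anti_pre_Lie_algebra_witt_circ bij_reflection
      reflection_witt_circ Vector_Spaces.linear_iff reflection_linear witt.vector_space_axioms)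

text \<open>Degrees bounded by \<open>M\<close> and \<open>N\<close> can add up to
  \<open>M + N\<close> only if both bounds are attained, so a single term survives.\<close>

lemma lookup_graded_op_top:
  assumes x: "\<And>m. m \<in> Poly_Mapping.keys x \<Longrightarrow> m \<le> M"
    and y: "\<And>n. n \<in> Poly_Mapping.keys y \<Longrightarrow> n \<le> N"
  shows "Poly_Mapping.lookup (graded_op \<phi> x y) (M + N) =
    Poly_Mapping.lookup x M * Poly_Mapping.lookup y N * \<phi> M N"
proof -
  \<comment> \<open>\<open>M\<close> and \<open>N\<close> are only upper bounds; inserting them lets
    \<open>sum.delta\<close> apply even when they lie outside the supports.\<close>
  let ?A = "insert M (Poly_Mapping.keys x)" and ?B = "insert N (Poly_Mapping.keys y)"
  let ?c = "\<lambda>m n. Poly_Mapping.lookup x m * Poly_Mapping.lookup y n * \<phi> m n"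
  have "Poly_Mapping.lookup (graded_op \<phi> x y) (M + N) =
      (\<Sum>m\<in>?A. \<Sum>n\<in>?B. ?c m n when m + n = M + N)"
    by (subst graded_op_superset[of ?A ?B])
      (auto simp: lookup_sum witt_scale_W lookup_single simp del: sum.insert sum.insert_if)
  also have "\<dots> = (\<Sum>m\<in>?A. \<Sum>n\<in>?B. if n = N then (if m = M then ?c M N else 0) else 0)"
    proof (intro sum.cong refl)
    fix m n assume "m \<in> ?A" "n \<in> ?B"
    then have "m \<le> M" "n \<le> N" using x y by auto
    then have "m + n = M + N \<longleftrightarrow> n = N \<and> m = M" by linarith
    then show "(?c m n when m + n = M + N) = (if n = N then (if m = M then ?c M N else 0) else 0)"
      by (auto simp: when_def)
  qed
  also have "\<dots> = ?c M N"
    by (simp add: sum.delta del: sum.insert sum.insert_if)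
  finally show ?thesis .
qed

lemma lookup_graded_op_W0:
  "Poly_Mapping.lookup (graded_op \<phi> (W 0) y) k = Poly_Mapping.lookup y k * \<phi> 0 k"
  by (subst graded_op_superset[of "{0}" "Poly_Mapping.keys y"])
    (auto simp: lookup_sum witt_scale_W lookup_single when_def in_keys_iff lookup_W
      split: if_splits)

text \<open>Bracketing with \<open>c W 0\<close> multiplies the coefficient at \<open>k\<close> by
  \<open>c * k\<close>; compare at any \<open>k\<close> in the support of \<open>y\<close>.\<close>

lemma witt_bracket_W0_eigenvalue:
  assumes "witt_bracket (witt_scale c (W 0)) y = witt_scale a y" "y \<noteq> 0"
  obtains k :: int where "c * of_int k = a"
proof -
  obtain k where k: "Poly_Mapping.lookup y k \<noteq> 0"
    using assms(2) by (metis poly_mapping_eqI lookup_zero)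
  have "c * (of_int k * Poly_Mapping.lookup y k) = a * Poly_Mapping.lookup y k"
    using arg_cong[OF assms(1), of "\<lambda>z. Poly_Mapping.lookup z k"]
    by (simp add: witt_bracket_def graded_op_linear lookup_graded_op_W0 mult.commute)
  with k have "c * of_int k = a" by simp
  then show ?thesis by (rule that)
qed

lemma isomorphism_W0_eigenvector:
  assumes "anti_pre_Lie_isomorphism witt_scale (witt_circ \<gamma>1) witt_scale (witt_circ \<gamma>2) f"
  shows "witt_bracket (f (W 0)) (f (W n)) = witt_scale (of_int n) (f (W n))"
  using anti_pre_Lie_isomorphism_commutator[OF assms, of "W 0" "W n"]
    anti_pre_Lie_isomorphismD(3)[OF assms]
  by (simp add: commutator_witt_circ witt_bracket_W)

lemma isomorphism_eq_0_iff:
  assumes "anti_pre_Lie_isomorphism s1 mul1 s2 mul2 f"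
  shows "f x = 0 \<longleftrightarrow> x = 0"
proof -
  have "f 0 = 0" using anti_pre_Lie_isomorphismD(2)[OF assms, of 0 0] by simp
  then show ?thesis
    using anti_pre_Lie_isomorphismD(1)[OF assms] by (metis bij_pointE)
qed

lemma W_neq_0 [simp]: "W n \<noteq> 0"
  by (metis W_def keys_single keys_zero insert_not_empty zero_neq_one)

lemma isomorphism_W0_keys_le:
  assumes f: "anti_pre_Lie_isomorphism witt_scale (witt_circ \<gamma>1) witt_scale (witt_circ \<gamma>2) f"
    and k: "k \<in> Poly_Mapping.keys (f (W 0))"
  shows "k \<le> 0"
proof (rule ccontr)
  assume "\<not> k \<le> 0"
  define x where "x = f (W 0)"
  define N where "N = Max (Poly_Mapping.keys x)"
  have N_ge: "m \<le> N" if "m \<in> Poly_Mapping.keys x" for m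
    using that by (simp add: N_def)
  have N_in: "N \<in> Poly_Mapping.keys x"
    unfolding N_def using k by (intro Max_in) (auto simp: x_def)
  have "N > 0" using N_ge[of k] k \<open>\<not> k \<le> 0\<close> by (simp add: x_def)
  have basis: "Poly_Mapping.lookup (f (W n)) j = 0" if "j > N" for n j
  proof -
    define y where "y = f (W n)"
    define M where "M = Max (Poly_Mapping.keys y)"
    have M_ge: "m \<le> M" if "m \<in> Poly_Mapping.keys y" for m
      using that by (simp add: M_def)
    have "y \<noteq> 0" by (simp add: y_def isomorphism_eq_0_iff[OF f])
    then have M_in: "M \<in> Poly_Mapping.keys y"
      unfolding M_def by (intro Max_in) auto
    have "witt_bracket x y = witt_scale (of_int n) y"
      unfolding x_def y_def by (rule isomorphism_W0_eigenvector[OF f])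
    \<comment> \<open>Since \<open>N > 0\<close>, the degree \<open>N + M\<close> lies above the top
      degree of \<open>y\<close>.\<close>
    moreover have "Poly_Mapping.lookup y (N + M) = 0"
      using M_ge[of "N + M"] \<open>N > 0\<close> by (auto simp: in_keys_iff)
    ultimately have "Poly_Mapping.lookup (witt_bracket x y) (N + M) = 0" by simp
    \<comment> \<open>The two leading coefficients are nonzero, so the structure constant
      \<open>M - N\<close> must vanish.\<close>
    then have "Poly_Mapping.lookup x N * Poly_Mapping.lookup y M * of_int (M - N) = 0"
      unfolding witt_bracket_def using lookup_graded_op_top[OF N_ge M_ge] by simp
    with N_in M_in have "M = N" by (simp add: in_keys_iff)
    then show ?thesis using M_ge[of j] that by (auto simp: y_def in_keys_iff)
  qed
  \<comment> \<open>The bound passes from the basis to the whole image of \<open>f\<close>, which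
    then misses \<open>W (N + 1)\<close>, against surjectivity.\<close>
  have "Poly_Mapping.lookup (f z) (N + 1) = 0" for z
  proof -
    have "z \<in> witt.span (range W)" by (simp add: witt_basis_span)
    then show ?thesis
      by (induction rule: witt.span_induct_alt)
        (auto simp: iffD2[OF isomorphism_eq_0_iff[OF f]] anti_pre_Lie_isomorphismD(2,3)[OF f]
          lookup_add basis)
  qed
  moreover obtain z where "f z = W (N + 1)"
    using anti_pre_Lie_isomorphismD(1)[OF f] by (metis bij_pointE)
  ultimately have "Poly_Mapping.lookup (W (N + 1)) (N + 1) = 0" by metis
  then show False by (simp add: lookup_W)
qed

lemma isomorphism_W0:
  assumes f: "anti_pre_Lie_isomorphism witt_scale (witt_circ \<gamma>1) witt_scale (witt_circ \<gamma>2) f"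
  obtains c where "f (W 0) = witt_scale c (W 0)" "c = 1 \<or> c = - 1"
proof -
  define c where "c = Poly_Mapping.lookup (f (W 0)) 0"
  have le: "k \<le> 0" if "k \<in> Poly_Mapping.keys (f (W 0))" for k
    by (rule isomorphism_W0_keys_le[OF f that])
  have ge: "k \<ge> 0" if "k \<in> Poly_Mapping.keys (f (W 0))" for k
  proof -
    \<comment> \<open>Composing with the reflection turns lower bounds on degrees into upper
      bounds.\<close>
    have "- k \<in> Poly_Mapping.keys ((reflection \<circ> f) (W 0))"
      using that by (simp add: in_keys_iff)
    then show ?thesis
      using isomorphism_W0_keys_le[OF anti_pre_Lie_isomorphism_comp[OF f reflection_isomorphism]]
      by fastforce
  qed
  have x: "f (W 0) = witt_scale c (W 0)"
  proof (rule poly_mapping_eqI)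
    show "Poly_Mapping.lookup (f (W 0)) k = Poly_Mapping.lookup (witt_scale c (W 0)) k" for k
    proof (cases "k = 0")
      case False
      then have "k \<notin> Poly_Mapping.keys (f (W 0))" using le ge by force
      with False show ?thesis by (simp add: lookup_W in_keys_iff)
    qed (simp add: c_def lookup_W)
  qed
  \<comment> \<open>The eigenvalue 1 of \<open>ad (W 0)\<close> must occur for
    \<open>ad (c W 0)\<close>, so \<open>c\<close> has an integer inverse \<open>k\<close>.\<close>
  have "witt_bracket (witt_scale c (W 0)) (f (W 1)) = witt_scale 1 (f (W 1))"
    using isomorphism_W0_eigenvector[OF f, of 1] by (simp add: x)
  then obtain k :: int where k: "c * of_int k = 1"
    by (rule witt_bracket_W0_eigenvalue) (simp add: isomorphism_eq_0_iff[OF f])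
  \<comment> \<open>Conversely, pulling \<open>W 1\<close> back makes \<open>c\<close> an eigenvalue
    of \<open>ad (W 0)\<close>, hence an integer. An integer with an integer inverse is 1 or
    -1.\<close>
  obtain z where z: "f z = W 1"
    using anti_pre_Lie_isomorphismD(1)[OF f] by (metis bij_pointE)
  have "f (witt_bracket (W 0) z) = f (witt_scale c z)"
    using anti_pre_Lie_isomorphism_commutator[OF f, of "W 0" z]
      anti_pre_Lie_isomorphismD(3)[OF f]
    by (simp add: commutator_witt_circ x z witt_bracket_def graded_op_linear)
  then have "witt_bracket (W 0) z = witt_scale c z"
    using anti_pre_Lie_isomorphismD(1)[OF f] by (metis bij_pointE)
  moreover have "z \<noteq> 0" using z isomorphism_eq_0_iff[OF f, of z] by auto
  ultimately obtain j :: int where j: "1 * of_int j = c"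
    using witt_bracket_W0_eigenvalue[of 1 z c] by auto
  from k j have "of_int (j * k) = (1 :: complex)" by simp
  then have "j * k = 1" by (simp only: of_int_eq_1_iff)
  then have "j = 1 \<or> j = - 1" by (auto simp: zmult_eq_1_iff)
  with j have "c = 1 \<or> c = - 1" by auto
  with x show ?thesis by (rule that)
qed

theorem theorem3p14:
  fixes \<gamma>1 \<gamma>2 :: complex
  shows "anti_pre_Lie_isomorphic witt_scale (witt_circ \<gamma>1) witt_scale (witt_circ \<gamma>2)
           \<longleftrightarrow> \<gamma>1 = \<gamma>2 \<or> \<gamma>1 = - \<gamma>2"
proof
  assume "anti_pre_Lie_isomorphic witt_scale (witt_circ \<gamma>1) witt_scale (witt_circ \<gamma>2)"
  then obtain f
    where f: "anti_pre_Lie_isomorphism witt_scale (witt_circ \<gamma>1) witt_scale (witt_circ \<gamma>2) f"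
    unfolding anti_pre_Lie_isomorphic_def by blast
  obtain c where x: "f (W 0) = witt_scale c (W 0)" and c: "c = 1 \<or> c = - 1"
    using isomorphism_W0[OF f] .
  \<comment> \<open>Linearity of \<open>f\<close> yields one factor \<open>c\<close>, the product in
    the target two.\<close>
  have "f (witt_circ \<gamma>1 (W 0) (W 0)) = witt_scale (- \<gamma>1 * c) (W 0)"
    by (simp add: witt_circ_W anti_pre_Lie_isomorphismD(3)[OF f] x del: witt.scale_minus_left)
  moreover have "witt_circ \<gamma>2 (f (W 0)) (f (W 0)) = witt_scale (- \<gamma>2 * c * c) (W 0)"
    by (simp add: x witt_circ_def graded_op_linear mult_ac del: witt.scale_minus_left)
  ultimately have "witt_scale (- \<gamma>1 * c) (W 0) = witt_scale (- \<gamma>2 * c * c) (W 0)"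
    using anti_pre_Lie_isomorphismD(4)[OF f] by metis
  then have "- \<gamma>1 * c = - \<gamma>2 * c * c"
    by (simp only: witt.scale_cancel_right W_neq_0 simp_thms)
  with c show "\<gamma>1 = \<gamma>2 \<or> \<gamma>1 = - \<gamma>2" by auto
next
  have "anti_pre_Lie_isomorphism witt_scale (witt_circ \<gamma>2) witt_scale (witt_circ \<gamma>2) id"
    by (simp add: anti_pre_Lie_isomorphism_def anti_pre_Lie_algebra_witt_circ
        Vector_Spaces.linear_iff witt.vector_space_axioms)
  moreover assume "\<gamma>1 = \<gamma>2 \<or> \<gamma>1 = - \<gamma>2"
  \<comment> \<open>The reflection taken at \<open>- \<gamma>2\<close> lands in parameter
    \<open>- (- \<gamma>2) = \<gamma>2\<close>.\<close>
  ultimately show "anti_pre_Lie_isomorphic witt_scale (witt_circ \<gamma>1) witt_scale (witt_circ \<gamma>2)"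
    unfolding anti_pre_Lie_isomorphic_def using reflection_isomorphism[of "- \<gamma>2"] by auto
qed

end
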